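(* Let $\mathbb K$ be a field. (1) For every potential $F\in\mathbb K\langle x,y\rangle$ having only terms of degree $3$ or higher, $\dim_{\mathbb K}A_F\ge 8$ (possibly infinite). (2) Moreover, the minimal dimension of the completion of $A_F$ is $8$: for every potential $F\in\mathbb K\langle x,y\rangle$ having only terms of degree $3$ or higher, the completion of $A_F$ has dimension at least $8$ over $\mathbb K$, and there exists such an $F$ for which the completion of $A_F$ has dimension exactly $8$.
   Context: $\mathbb K\langle x,y\rangle$ is the free associative unital algebra on $x,y$, with $\deg x=\deg y=1$. A polynomial $F\in\mathbb K\langle x,y\rangle$ is cyclicly invariant if it is fixed by the linear map sending each monomial $zu$ ($z\in\{x,y\}$, $u$ a monomial) to $uz$ and fixing constants. The linear maps $\partial_x,\partial_y:\mathbb K\langle x,y\rangle\to\mathbb K\langle x,y\rangle$ are defined on monomials by $\partial_x w=u$ if $w=xu$ and $\partial_x w=0$ otherwise; $\partial_y w=u$ if $w=yu$ and $\partial_y w=0$ otherwise. A potential is a cyclicly invariant polynomial $F$, and its potential algebra is $A_F=\mathbb K\langle x,y\rangle/I_F$, where $I_F$ is the two-sided ideal generated by $\partial_xF$ and $\partial_yF$. Let $F[n]$ denote the linear span of all monomials in $\mathbb K\langle x,y\rangle$ of degree at least $n$. For an ideal $I$ of $\mathbb K\langle x,y\rangle$, its closure is $\bar I=\bigcap_{n}(I+F[n])$, and $\mathbb K\langle x,y\rangle/\bar I$ is called the completion of the algebra $\mathbb K\langle x,y\rangle/I$. *)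

theory Defs
  imports
    "HOL-Algebra.Algebraic_Closure_Type"
    "HOL-Algebra.Embedded_Algebras"
    "HOL-Library.Poly_Mapping"
    "HOL-Library.Extended_Nat"
begin

section \<open>The free associative algebra on two generators\<close>

datatype gen = GX | GY

text \<open>
  Monomials are words in the generators. Lists are made into the free monoid (written additively,
  with concatenation as addition), so that the convolution product on finitely supported
  functions is the multiplication of the monoid algebra, i.e. of the free algebra.
\<close>

instantiation list :: (type) monoid_add
begin

definition zero_list :: "'a list" where "zero_list = []"

definition plus_list :: "'a list \<Rightarrow> 'a list \<Rightarrow> 'a list" where "plus_list = (@)"

instance by standard (simp_all add: zero_list_def plus_list_def)

end

type_synonym 'k free_alg = "gen list \<Rightarrow>\<^sub>0 'k"

definition monomial :: "gen list \<Rightarrow> 'k::field free_alg" where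
  "monomial w = Poly_Mapping.single w 1"

definition const :: "'k::field \<Rightarrow> 'k free_alg" where
  "const c = Poly_Mapping.single [] c"

definition scale :: "'k::field \<Rightarrow> 'k free_alg \<Rightarrow> 'k free_alg" where
  "scale c p = const c * p"

lemma const_add: "const (a + b) = const a + const b"
  by (simp add: const_def Poly_Mapping.single_add)

lemma const_mult: "const (a * b) = const a * const b"
  by (simp add: const_def Poly_Mapping.mult_single plus_list_def)

lemma const_1: "const 1 = 1"
  by (simp add: const_def flip: zero_list_def)

global_interpretation free_alg: vector_space scale
  by unfold_locales
    (simp_all add: scale_def const_add const_mult const_1 algebra_simps)

definition linear_ext :: "(gen list \<Rightarrow> 'k free_alg) \<Rightarrow> 'k::field free_alg \<Rightarrow> 'k free_alg" where
  "linear_ext f p = (\<Sum>w\<in>Poly_Mapping.keys p. scale (Poly_Mapping.lookup p w) (f w))"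


section \<open>Potentials and their algebras\<close>

definition cyc :: "'k::field free_alg \<Rightarrow> 'k free_alg" where
  "cyc = linear_ext (\<lambda>w. monomial (case w of [] \<Rightarrow> [] | z # u \<Rightarrow> u @ [z]))"

definition potential :: "'k::field free_alg \<Rightarrow> bool" where
  "potential F \<longleftrightarrow> cyc F = F"

definition left_deriv :: "gen \<Rightarrow> 'k::field free_alg \<Rightarrow> 'k free_alg" where
  "left_deriv g = linear_ext (\<lambda>w. case w of [] \<Rightarrow> 0 | z # u \<Rightarrow> if z = g then monomial u else 0)"

definition terms_degree_ge :: "nat \<Rightarrow> 'k::field free_alg \<Rightarrow> bool" where
  "terms_degree_ge n F \<longleftrightarrow> (\<forall>w\<in>Poly_Mapping.keys F. n \<le> length w)"

abbreviation free_ring :: "'k::field free_alg ring" where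
  "free_ring \<equiv> ring_of_type_algebra"

definition potential_ideal :: "'k::field free_alg \<Rightarrow> 'k free_alg set" where
  "potential_ideal F = genideal free_ring {left_deriv GX F, left_deriv GY F}"

definition potential_algebra :: "'k::field free_alg \<Rightarrow> 'k free_alg set ring" where
  "potential_algebra F = free_ring Quot (potential_ideal F)"

definition degree_filtration :: "nat \<Rightarrow> 'k::field free_alg set" where
  "degree_filtration n = free_alg.span (monomial ` {w. n \<le> length w})"

definition ideal_closure :: "'k::field free_alg set \<Rightarrow> 'k free_alg set" where
  "ideal_closure I = (\<Inter>n. I <+>\<^bsub>free_ring\<^esub> degree_filtration n)"

definition completed_potential_algebra :: "'k::field free_alg \<Rightarrow> 'k free_alg set ring" where
  "completed_potential_algebra F = free_ring Quot (ideal_closure (potential_ideal F))"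


section \<open>Dimension of quotients\<close>

text \<open>
  The library measures dimension over a set of scalars inside the ring itself; for a quotient of
  the free algebra these are the cosets of the constants. \<open>ring.dim\<close> is only meaningful
  for finite-dimensional spaces, hence the value \<open>\<infinity>\<close> otherwise.
\<close>

definition ring_dim :: "'a set \<Rightarrow> 'a ring \<Rightarrow> enat" where
  "ring_dim K A =
    (if ring.finite_dimension A K (carrier A) then enat (ring.dim A K (carrier A)) else \<infinity>)"

definition quot_scalars :: "'k::field free_alg set \<Rightarrow> 'k free_alg set set" where
  "quot_scalars I = (\<lambda>c. I +>\<^bsub>free_ring\<^esub> const c) ` UNIV"

definition dim_potential_algebra :: "'k::field free_alg \<Rightarrow> enat" where
  "dim_potential_algebra F = ring_dim (quot_scalars (potential_ideal F)) (potential_algebra F)"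

definition dim_completion :: "'k::field free_alg \<Rightarrow> enat" where
  "dim_completion F =
    ring_dim (quot_scalars (ideal_closure (potential_ideal F))) (completed_potential_algebra F)"


section \<open>Well-definedness\<close>

lemma ring_free_ring: "ring (free_ring :: 'k::field free_alg ring)"
proof -
  have "\<exists>y. x + y = 0" "\<exists>y. y + x = 0" for x :: "'k free_alg"
    by (rule exI[of _ "- x"], simp)+
  thus ?thesis
    unfolding ring_of_type_algebra_def
    by unfold_locales (auto simp: algebra_simps Units_def)
qed

lemma ideal_potential_ideal: "ideal (potential_ideal F) free_ring"
  unfolding potential_ideal_def
  by (rule ring.genideal_ideal[OF ring_free_ring]) (simp add: ring_of_type_algebra_def)

lemma mem_ideal_closure:
  "p \<in> ideal_closure I \<longleftrightarrow> (\<forall>n. \<exists>a\<in>I. \<exists>b\<in>degree_filtration n. p = a + b)"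
  by (simp add: ideal_closure_def set_add_def set_mult_def ring_of_type_algebra_def)

lemma free_alg_induct [case_names single add]:
  fixes p :: "'k::field free_alg"
  assumes single: "\<And>w c. P (Poly_Mapping.single w c)"
    and add: "\<And>p q. P p \<Longrightarrow> P q \<Longrightarrow> P (p + q)"
  shows "P p"
proof (induction p rule: Poly_Mapping.update_induct)
  case const
  show ?case using single[of "[]" 0] by simp
next
  case (update p w c)
  have "Poly_Mapping.update w c p = Poly_Mapping.single w c + p"
    using update(1)
    by (intro poly_mapping_eqI)
      (auto simp: Poly_Mapping.lookup_update Poly_Mapping.lookup_add Poly_Mapping.lookup_single
        when_def Poly_Mapping.in_keys_iff)
  thus ?case using add single update by simp
qed

lemma degree_filtration_mult:
  assumes "b \<in> degree_filtration n"
  shows "p * b \<in> degree_filtration n" "b * p \<in> degree_filtration n"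
proof -
  have single: "Poly_Mapping.single w c \<in> degree_filtration n" if "n \<le> length w" for w and c :: 'a
  proof -
    have "Poly_Mapping.single w c = scale c (monomial w)"
      by (simp add: scale_def const_def monomial_def Poly_Mapping.mult_single plus_list_def)
    thus ?thesis
      unfolding degree_filtration_def using that by (metis (mono_tags, lifting) free_alg.span_scale free_alg.span_base imageI mem_Collect_eq)
  qed
  have add: "x + y \<in> degree_filtration n"
    if "x \<in> degree_filtration n" "y \<in> degree_filtration n" for x y :: "'a free_alg"
    using that unfolding degree_filtration_def by (rule free_alg.span_add)
  have zero: "0 \<in> degree_filtration n" by (simp add: degree_filtration_def free_alg.span_zero)
  have monomial: "p * monomial w \<in> degree_filtration n" "monomial w * p \<in> degree_filtration n"
    if "n \<le> length w" for w and p :: "'a free_alg"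
    by (induction p rule: free_alg_induct;
        use that in \<open>simp add: monomial_def Poly_Mapping.mult_single plus_list_def single distrib_left distrib_right add\<close>)+
  have comm: "p * scale c x = scale c (p * x)" for c and p x :: "'a free_alg"
  proof -
    have "p * const c = const c * p"
    proof (induction p rule: free_alg_induct)
      case (single k v)
      show ?case by (simp add: const_def Poly_Mapping.mult_single plus_list_def mult.commute)
    qed (simp_all add: algebra_simps)
    thus ?thesis by (simp add: scale_def flip: mult.assoc)
  qed
  have scale: "scale c x \<in> degree_filtration n" if "x \<in> degree_filtration n" for c and x :: "'a free_alg"
    using that unfolding degree_filtration_def by (rule free_alg.span_scale)
  have "p * b \<in> degree_filtration n \<and> b * p \<in> degree_filtration n"
    using assms unfolding degree_filtration_def
  proof (induction b rule: free_alg.span_induct_alt)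
    case base
    show ?case by (simp add: free_alg.span_zero)
  next
    case (step c x y)
    then obtain w where w: "n \<le> length w" "x = monomial w" by auto
    have "p * scale c x \<in> degree_filtration n" using w by (simp add: comm scale monomial)
    moreover have "scale c x * p \<in> degree_filtration n"
      using w scale[OF monomial(2)[OF w(1)]] by (simp add: scale_def mult.assoc)
    ultimately show ?case using step add
      by (simp add: distrib_left distrib_right degree_filtration_def)
  qed
  thus "p * b \<in> degree_filtration n" "b * p \<in> degree_filtration n" by auto
qed

lemma ideal_ideal_closure:
  assumes "ideal I (free_ring :: 'k::field free_alg ring)"
  shows "ideal (ideal_closure I) free_ring"
proof (rule idealI[OF ring_free_ring])
  interpret ring "free_ring :: 'k free_alg ring" by (rule ring_free_ring)
  have simps: "add free_ring = ((+) :: 'k free_alg \<Rightarrow> _)" "zero free_ring = (0 :: 'k free_alg)"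
    "monoid.mult free_ring = ((*) :: 'k free_alg \<Rightarrow> _)" "carrier free_ring = (UNIV :: 'k free_alg set)"
    by (simp_all add: ring_of_type_algebra_def)
  have neg: "a_inv free_ring x = - x" for x :: "'k free_alg"
  proof -
    have "x \<oplus>\<^bsub>free_ring\<^esub> a_inv free_ring x = \<zero>\<^bsub>free_ring\<^esub>"
      by (rule r_neg) (simp add: simps)
    thus ?thesis unfolding simps by (simp add: eq_neg_iff_add_eq_0 add.commute)
  qed
  note I = additive_subgroup.a_closed[OF ideal.axioms(1)[OF assms], unfolded simps]
    additive_subgroup.zero_closed[OF ideal.axioms(1)[OF assms], unfolded simps]
    additive_subgroup.a_inv_closed[OF ideal.axioms(1)[OF assms], unfolded neg]
    ideal.I_l_closed[OF assms, unfolded simps, OF _ UNIV_I]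
    ideal.I_r_closed[OF assms, unfolded simps, OF _ UNIV_I]
  note D = free_alg.span_add[of _ "monomial ` {w. n \<le> length w}" for n, folded degree_filtration_def]
    free_alg.span_neg[of _ "monomial ` {w. n \<le> length w}" for n, folded degree_filtration_def]
    free_alg.span_zero[of "monomial ` {w. n \<le> length w}" for n, folded degree_filtration_def]
  show "subgroup (ideal_closure I) (add_monoid free_ring)"
  proof (rule group.subgroupI)
    show "group (add_monoid (free_ring :: 'k free_alg ring))" by (rule a_group)
    show "ideal_closure I \<noteq> {}"
      using I(2) D(3) by (metis (no_types, lifting) mem_ideal_closure add_0 empty_iff)
  next
    fix a assume a: "a \<in> ideal_closure I"
    have "- a \<in> ideal_closure I"
      unfolding mem_ideal_closure
    proof
      fix n
      from a obtain x y where "x \<in> I" "y \<in> degree_filtration n" "a = x + y"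
        unfolding mem_ideal_closure by blast
      thus "\<exists>x\<in>I. \<exists>y\<in>degree_filtration n. - a = x + y"
        using I(3) D(2) by (metis minus_add_distrib)
    qed
    thus "inv\<^bsub>add_monoid free_ring\<^esub> a \<in> ideal_closure I"
      using neg[of a] by (simp add: a_inv_def)
  next
    fix a b assume ab: "a \<in> ideal_closure I" "b \<in> ideal_closure I"
    have "a + b \<in> ideal_closure I"
      unfolding mem_ideal_closure
    proof
      fix n
      from ab obtain x y x' y' where "x \<in> I" "y \<in> degree_filtration n" "a = x + y"
        "x' \<in> I" "y' \<in> degree_filtration n" "b = x' + y'"
        unfolding mem_ideal_closure by meson
      thus "\<exists>x\<in>I. \<exists>y\<in>degree_filtration n. a + b = x + y"
        by (intro bexI[of _ "x + x'"] bexI[of _ "y + y'"]) (auto intro: I D simp: algebra_simps)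
    qed
    thus "a \<otimes>\<^bsub>add_monoid free_ring\<^esub> b \<in> ideal_closure I" by (simp add: simps)
  qed (simp add: simps)
next
  fix a x :: "'k free_alg" assume a: "a \<in> ideal_closure I"
  have "x * a \<in> ideal_closure I" "a * x \<in> ideal_closure I"
    using a ideal.I_l_closed[OF assms] ideal.I_r_closed[OF assms]
    unfolding mem_ideal_closure
    by (simp_all add: ring_of_type_algebra_def)
      (metis degree_filtration_mult distrib_left distrib_right)+
  thus "x \<otimes>\<^bsub>free_ring\<^esub> a \<in> ideal_closure I" "a \<otimes>\<^bsub>free_ring\<^esub> x \<in> ideal_closure I"
    by (simp_all add: ring_of_type_algebra_def)
qed

lemma subfield_quot_scalars:
  fixes I :: "'k::field free_alg set"
  assumes "ideal I free_ring" "I \<noteq> UNIV"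
  shows "subfield (quot_scalars I) (free_ring Quot I)"
proof -
  interpret I: ideal I free_ring by fact
  interpret h: ring_hom_ring free_ring "free_ring Quot I" "(+>\<^bsub>free_ring\<^esub>) I"
    by (rule I.rcos_ring_hom_ring)
  have carr: "carrier free_ring = (UNIV :: 'k free_alg set)"
    by (simp add: ring_of_type_algebra_def)
  have const_eq: "const a = const b \<longleftrightarrow> a = b" for a b :: 'k
    unfolding const_def by (metis Poly_Mapping.lookup_single_eq)
  have one: "\<one>\<^bsub>free_ring\<^esub> = (const 1 :: 'k free_alg)"
    by (simp add: ring_of_type_algebra_def const_1)
  have zero: "\<zero>\<^bsub>free_ring\<^esub> = (const 0 :: 'k free_alg)"
    by (simp add: ring_of_type_algebra_def const_def)
  have ops: "x \<oplus>\<^bsub>free_ring\<^esub> y = x + y" "x \<otimes>\<^bsub>free_ring\<^esub> y = x * y" for x y :: "'k free_alg"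
    by (simp_all add: ring_of_type_algebra_def)
  have inv: "\<ominus>\<^bsub>free_ring\<^esub> const c = const (- c)" for c :: 'k
    by (rule I.minus_equality) (simp_all add: carr zero ops flip: const_add)
  have "subring (range const) (free_ring :: 'k free_alg ring)"
    by (rule I.subringI)
      (auto simp: carr one inv ops simp flip: const_add const_mult)
  moreover have "subcring (range const) (free_ring :: 'k free_alg ring)"
    using calculation by (rule subcring.intro)
      (auto intro!: subcring_axioms.intro simp: ops mult.commute simp flip: const_mult)
  ultimately have "subfield (range const) (free_ring :: 'k free_alg ring)"
  proof (intro I.subfieldI)
    show "Units (free_ring\<lparr>carrier := range const\<rparr>) = range const - {\<zero>\<^bsub>free_ring\<^esub> :: 'k free_alg}"
    proof (intro equalityI subsetI)
      fix x :: "'k free_alg" assume "x \<in> range const - {\<zero>\<^bsub>free_ring\<^esub>}"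
      then obtain c where c: "x = const c" "c \<noteq> 0" by (auto simp: zero const_eq)
      thus "x \<in> Units (free_ring\<lparr>carrier := range const\<rparr>)"
        unfolding Units_def using const_mult[of c "inverse c"] const_mult[of "inverse c" c]
        by (auto intro!: bexI[of _ "const (inverse c)"] simp: one ops)
    next
      fix x :: "'k free_alg" assume "x \<in> Units (free_ring\<lparr>carrier := range const\<rparr>)"
      thus "x \<in> range const - {\<zero>\<^bsub>free_ring\<^esub>}"
        by (auto simp: Units_def zero one ops const_eq simp flip: const_mult)
    qed
  qed
  moreover have "\<one>\<^bsub>free_ring Quot I\<^esub> \<noteq> \<zero>\<^bsub>free_ring Quot I\<^esub>"
  proof
    assume "\<one>\<^bsub>free_ring Quot I\<^esub> = \<zero>\<^bsub>free_ring Quot I\<^esub>"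
    hence "I +>\<^bsub>free_ring\<^esub> \<one>\<^bsub>free_ring\<^esub> = I"
      unfolding FactRing_def by (simp only: monoid.simps ring.simps partial_object.simps)
    hence "\<one>\<^bsub>free_ring\<^esub> \<in> I" using I.a_rcos_self[OF I.one_closed] by (simp only:)
    hence "I = carrier free_ring" by (rule I.one_imp_carrier)
    with assms(2) carr show False by metis
  qed
  ultimately have "subfield ((+>\<^bsub>free_ring\<^esub>) I ` range const) (free_ring Quot I)"
    by (rule h.img_is_subfield(2))
  thus ?thesis by (simp add: quot_scalars_def image_image)
qed

end

theory Submission
  imports Defs
begin

text \<open>
  Let \<open>r = \<partial>\<^sub>xF\<close>, \<open>s = \<partial>\<^sub>yF\<close> and let \<open>I\<close> be the ideal they generate. The closure of \<open>I\<close> is contained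
  in \<open>I + F[5]\<close>, so both lower bounds follow once \<open>I + F[5]\<close> is shown to have codimension at least 8.
  Modulo \<open>F[5]\<close>, the ideal is spanned by the elements \<open>u r v\<close> and \<open>u s v\<close> with \<open>u\<close>, \<open>v\<close> words and
  \<open>|u| + |v| \<le> 2\<close>, and they are counted according to \<open>n = |u| + |v|\<close>.

  For \<open>n = 2\<close> only the quadratic parts of \<open>r\<close> and \<open>s\<close> matter modulo \<open>F[5]\<close>. By cyclic invariance
  their coefficients at \<open>xx, xy, yx, yy\<close> are \<open>(a, b, b, c)\<close> and \<open>(b, c, c, d)\<close>, where \<open>a, b, c, d\<close> are
  the cubic coefficients of \<open>F\<close>. For all values of these, two linearly independent functionals on the
  span of the words of length 4 vanish on the 24 elements with \<open>n = 2\<close>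
  (\<open>two_contracted_functionals\<close>): a nonzero vector \<open>(\<alpha>, \<beta>, \<gamma>)\<close> orthogonal to both \<open>(a, b, c)\<close> and
  \<open>(b, c, d)\<close> is a binary quadratic form, over an algebra of degree 2 it splits into two linear
  factors, and applying the factors alternately to the letters of a word gives a functional with
  values in that algebra, whose two coordinates are the functionals sought.

  For \<open>n = 1\<close> there are 8 elements, but cyclic invariance gives \<open>x r + y s = r x + s y\<close>
  (\<open>potential_syzygy\<close>), so they span at most 7 dimensions; \<open>n = 0\<close> contributes at most 2. The space
  spanned by the 15 words of length at most 3 together with the two functionals has dimension 17, so
  that \<open>17 - 7 - 2 = 8\<close> dimensions survive (\<open>card_spanning_set_modulo_closure\<close>).

  The bound is attained by \<open>F = x\<^sup>3 + y\<^sup>3 + xyxy + yxyx\<close>. Its relations are \<open>x\<^sup>2 = - yxy\<close> and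
  \<open>y\<^sup>2 = - xyx\<close>, and computing \<open>x\<^sup>3\<close> in two ways gives \<open>xyxy = yxyx\<close>. Hence \<open>xyxyx = x\<^sup>2yxy = - yxyyxy\<close>,
  and every word of length at least 5 can be rewritten into longer and longer words, so it vanishes in
  the completion. What remains are the alternating words of length at most 4, with the two of
  length 4 identified: \<open>1, x, y, xy, yx, xyx, yxy, xyxy\<close>.
\<close>

section \<open>Linear maps and words\<close>

lemma monomial_append: "monomial (u @ v) = monomial u * monomial v"
  by (simp add: monomial_def Poly_Mapping.mult_single plus_list_def)

lemma monomial_Nil: "monomial [] = 1"
  by (simp add: monomial_def flip: zero_list_def)

lemma single_eq_scale: "Poly_Mapping.single w c = scale c (monomial w)"
  by (simp add: scale_def const_def monomial_def Poly_Mapping.mult_single plus_list_def)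

lemma lookup_scale: "Poly_Mapping.lookup (scale c p) w = c * Poly_Mapping.lookup p w"
proof (induction p rule: free_alg_induct)
  case (single v k)
  show ?case
    by (simp add: scale_def const_def Poly_Mapping.mult_single plus_list_def
        Poly_Mapping.lookup_single when_def)
qed (simp add: free_alg.scale_right_distrib Poly_Mapping.lookup_add distrib_left)

lemma const_commutes: "p * const c = const c * p"
proof (induction p rule: free_alg_induct)
  case (single k v)
  show ?case by (simp add: const_def Poly_Mapping.mult_single plus_list_def mult.commute)
qed (simp_all add: algebra_simps)

lemma mult_scale: "p * scale c q = scale c (p * q)"
  by (simp add: scale_def const_commutes flip: mult.assoc)

lemma scale_mult: "scale c p * q = scale c (p * q)"
  by (simp add: scale_def mult.assoc)

lemma linear_ext_superset:
  assumes "finite A" "Poly_Mapping.keys p \<subseteq> A"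
  shows "linear_ext f p = (\<Sum>w\<in>A. scale (Poly_Mapping.lookup p w) (f w))"
  unfolding linear_ext_def using assms
  by (intro sum.mono_neutral_left) (auto simp: Poly_Mapping.in_keys_iff)

lemma linear_ext_add: "linear_ext f (p + q) = linear_ext f p + linear_ext f q"
proof -
  let ?A = "Poly_Mapping.keys p \<union> Poly_Mapping.keys q"
  have "linear_ext f (p + q) = (\<Sum>w\<in>?A. scale (Poly_Mapping.lookup (p + q) w) (f w))"
    using Poly_Mapping.keys_add[of p q] by (intro linear_ext_superset) auto
  also have "\<dots> = (\<Sum>w\<in>?A. scale (Poly_Mapping.lookup p w) (f w))
      + (\<Sum>w\<in>?A. scale (Poly_Mapping.lookup q w) (f w))"
    by (simp add: Poly_Mapping.lookup_add free_alg.scale_left_distrib sum.distrib)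
  also have "\<dots> = linear_ext f p + linear_ext f q"
    by (subst (1 2) linear_ext_superset[of ?A]) auto
  finally show ?thesis .
qed

lemma linear_ext_single: "linear_ext f (Poly_Mapping.single w c) = scale c (f w)"
  by (subst linear_ext_superset[of "{w}"]) auto

lemma linear_ext_monomial: "linear_ext f (monomial w) = f w"
  by (simp add: monomial_def linear_ext_single)

lemma linear_ext_scale: "linear_ext f (scale c p) = scale c (linear_ext f p)"
proof -
  have "Poly_Mapping.keys (scale c p) \<subseteq> Poly_Mapping.keys p"
    by (auto simp: Poly_Mapping.in_keys_iff lookup_scale)
  then have "linear_ext f (scale c p)
      = (\<Sum>w\<in>Poly_Mapping.keys p. scale (Poly_Mapping.lookup (scale c p) w) (f w))"
    by (intro linear_ext_superset) auto
  then show ?thesis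
    by (simp add: linear_ext_def lookup_scale free_alg.scale_sum_right)
qed

lemma module_hom_linear_ext: "module_hom scale scale (linear_ext f)"
  by unfold_locales
    (simp_all add: linear_ext_add linear_ext_scale free_alg.scale_right_distrib
      free_alg.scale_left_distrib)

lemma linear_ext_sandwich:
  "linear_ext f (monomial u * p * monomial v) = linear_ext (\<lambda>w. f (u @ w @ v)) p"
proof (induction p rule: free_alg_induct)
  case (single w c)
  show ?case
    by (simp add: single_eq_scale mult_scale scale_mult linear_ext_scale linear_ext_monomial
        flip: monomial_append)
next
  case (add p q)
  then show ?case by (simp add: linear_ext_add distrib_left distrib_right)
qed

lemma lookup_left_deriv:
  "Poly_Mapping.lookup (left_deriv g F) w = Poly_Mapping.lookup F (g # w)"
proof (induction F rule: free_alg_induct)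
  case (single v c)
  show ?case
    by (auto simp: left_deriv_def linear_ext_single lookup_scale monomial_def
        Poly_Mapping.lookup_single when_def split: list.split)
next
  case (add p q)
  then show ?case by (simp add: left_deriv_def linear_ext_add Poly_Mapping.lookup_add)
qed

lemma lookup_cyc:
  "Poly_Mapping.lookup (cyc F) (w @ [g]) = Poly_Mapping.lookup F (g # w)"
proof (induction F rule: free_alg_induct)
  case (single v c)
  show ?case
    by (auto simp: cyc_def linear_ext_single lookup_scale monomial_def
        Poly_Mapping.lookup_single when_def split: list.split)
next
  case (add p q)
  then show ?case by (simp add: cyc_def linear_ext_add Poly_Mapping.lookup_add)
qed

lemma lookup_letter_mult:
  fixes p :: "'k::field free_alg"
  shows "Poly_Mapping.lookup (monomial [g] * p) w =
     (case w of [] \<Rightarrow> 0 | z # u \<Rightarrow> if z = g then Poly_Mapping.lookup p u else 0)"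
proof (induction p rule: free_alg_induct)
  case (single v c)
  show ?case
    by (auto simp: monomial_def Poly_Mapping.mult_single
        plus_list_def Poly_Mapping.lookup_single when_def split: list.split)
next
  case (add p q)
  then show ?case by (auto simp: distrib_left Poly_Mapping.lookup_add split: list.split)
qed

lemma lookup_mult_letter:
  fixes p :: "'k::field free_alg"
  shows "Poly_Mapping.lookup (p * monomial [g]) (u @ [z]) =
     (if z = g then Poly_Mapping.lookup p u else 0)"
  "Poly_Mapping.lookup (p * monomial [g]) [] = 0"
proof (induction p rule: free_alg_induct)
  case (single v c)
  { case 1 show ?case
    by (auto simp: monomial_def Poly_Mapping.mult_single
        plus_list_def Poly_Mapping.lookup_single when_def)
  next
    case 2 show ?case
    by (auto simp: monomial_def Poly_Mapping.mult_single
        plus_list_def Poly_Mapping.lookup_single when_def) }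
next
  case (add p q)
  { case 1 from add show ?case by (auto simp: distrib_right Poly_Mapping.lookup_add)
  next
    case 2 from add show ?case by (auto simp: distrib_right Poly_Mapping.lookup_add) }
qed

lemma potential_rotate:
  assumes "potential F"
  shows "Poly_Mapping.lookup F (w @ [g]) = Poly_Mapping.lookup F (g # w)"
  using lookup_cyc[of F w g] assms by (simp add: potential_def)

text \<open>
  Both sides put the first, respectively the last, letter of each word of \<open>F\<close> back in its place; the
  left-hand side is \<open>F\<close> without its constant term, and cyclic invariance says the same of the right.
\<close>

lemma potential_syzygy:
  assumes "potential F"
  shows "monomial [GX] * left_deriv GX F + monomial [GY] * left_deriv GY F =
         left_deriv GX F * monomial [GX] + left_deriv GY F * monomial [GY]"
proof (rule poly_mapping_eqI)
  fix w :: "gen list"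
  have g: "g = GX \<or> g = GY" for g by (cases g) auto
  show "Poly_Mapping.lookup (monomial [GX] * left_deriv GX F + monomial [GY] * left_deriv GY F) w =
        Poly_Mapping.lookup (left_deriv GX F * monomial [GX] + left_deriv GY F * monomial [GY]) w"
  proof (cases w)
    case Nil
    then show ?thesis
      by (simp add: Poly_Mapping.lookup_add lookup_letter_mult lookup_mult_letter)
  next
    case (Cons z u)
    have l: "Poly_Mapping.lookup (monomial [GX] * left_deriv GX F + monomial [GY] * left_deriv GY F) w
        = Poly_Mapping.lookup F w"
      using Cons g[of z] by (auto simp: Poly_Mapping.lookup_add lookup_letter_mult lookup_left_deriv)
    obtain v y where w: "w = v @ [y]" using Cons by (metis list.distinct(1) rev_exhaust)
    show ?thesis unfolding l unfolding w
      using g[of y] potential_rotate[OF assms, of v y]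
      by (auto simp: Poly_Mapping.lookup_add lookup_mult_letter lookup_left_deriv)
  qed
qed

section \<open>Ideals of the free algebra\<close>

lemma free_ring_simps:
  "add free_ring = ((+) :: 'k::field free_alg \<Rightarrow> _)" "zero free_ring = (0 :: 'k free_alg)"
  "monoid.mult free_ring = ((*) :: 'k free_alg \<Rightarrow> _)" "carrier free_ring = (UNIV :: 'k free_alg set)"
  "one free_ring = (1 :: 'k free_alg)"
  by (simp_all add: ring_of_type_algebra_def)

lemma free_ring_a_inv: "\<ominus>\<^bsub>free_ring\<^esub> x = - (x :: 'k::field free_alg)"
proof -
  interpret ring "free_ring :: 'k free_alg ring" by (rule ring_free_ring)
  have "x \<oplus>\<^bsub>free_ring\<^esub> a_inv free_ring x = \<zero>\<^bsub>free_ring\<^esub>"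
    by (rule r_neg) (simp add: free_ring_simps)
  thus ?thesis unfolding free_ring_simps by (simp add: eq_neg_iff_add_eq_0 add.commute)
qed

lemma ideal_closed:
  assumes "ideal I (free_ring :: 'k::field free_alg ring)"
  shows "0 \<in> I" "x \<in> I \<Longrightarrow> y \<in> I \<Longrightarrow> x + y \<in> I" "x \<in> I \<Longrightarrow> - x \<in> I"
    "x \<in> I \<Longrightarrow> y \<in> I \<Longrightarrow> x - y \<in> I"
    "x \<in> I \<Longrightarrow> p * x \<in> I" "x \<in> I \<Longrightarrow> x * p \<in> I" "x \<in> I \<Longrightarrow> scale c x \<in> I"
proof -
  note I = additive_subgroup.a_closed[OF ideal.axioms(1)[OF assms], unfolded free_ring_simps]
    additive_subgroup.zero_closed[OF ideal.axioms(1)[OF assms], unfolded free_ring_simps]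
    additive_subgroup.a_inv_closed[OF ideal.axioms(1)[OF assms], unfolded free_ring_a_inv]
    ideal.I_l_closed[OF assms, unfolded free_ring_simps, OF _ UNIV_I]
    ideal.I_r_closed[OF assms, unfolded free_ring_simps, OF _ UNIV_I]
  show "0 \<in> I" "x \<in> I \<Longrightarrow> y \<in> I \<Longrightarrow> x + y \<in> I" "x \<in> I \<Longrightarrow> - x \<in> I"
    "x \<in> I \<Longrightarrow> p * x \<in> I" "x \<in> I \<Longrightarrow> x * p \<in> I" "x \<in> I \<Longrightarrow> scale c x \<in> I"
    using I by (auto simp: scale_def)
  show "x \<in> I \<Longrightarrow> y \<in> I \<Longrightarrow> x - y \<in> I"
    using I by (metis add_uminus_conv_diff)
qed

lemma left_deriv_in_potential_ideal: "left_deriv g F \<in> potential_ideal F"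
  using ring.genideal_self[OF ring_free_ring, of "{left_deriv GX F, left_deriv GY F}"]
  by (cases g) (auto simp: potential_ideal_def free_ring_simps)

lemma ideal_span_sandwiches:
  "ideal (free_alg.span {monomial u * g * monomial v | u g v. g \<in> G}) (free_ring :: 'k::field free_alg ring)"
    (is "ideal (free_alg.span ?S) _")
proof (rule idealI[OF ring_free_ring])
  interpret ring "free_ring :: 'k free_alg ring" by (rule ring_free_ring)
  show "subgroup (free_alg.span ?S) (add_monoid free_ring)"
  proof (rule group.subgroupI)
    show "group (add_monoid (free_ring :: 'k free_alg ring))" by (rule a_group)
    show "free_alg.span ?S \<noteq> {}" using free_alg.span_zero by blast
    fix a assume "a \<in> free_alg.span ?S"
    then have "\<ominus>\<^bsub>free_ring\<^esub> a \<in> free_alg.span ?S"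
      by (simp add: free_ring_a_inv free_alg.span_neg)
    then show "inv\<^bsub>add_monoid free_ring\<^esub> a \<in> free_alg.span ?S" by (simp add: a_inv_def)
  qed (auto simp: free_ring_simps free_alg.span_add)
next
  fix a x :: "'k free_alg" assume a: "a \<in> free_alg.span ?S"
  have words: "monomial w * a \<in> free_alg.span ?S \<and> a * monomial w \<in> free_alg.span ?S" for w
    using a
  proof (induction a rule: free_alg.span_induct_alt)
    case base
    then show ?case by (simp add: free_alg.span_zero)
  next
    case (step c s y)
    then obtain u g v where s: "s = monomial u * g * monomial v" "g \<in> G" by auto
    have "monomial w * s = monomial (w @ u) * g * monomial v"
      "s * monomial w = monomial u * g * monomial (v @ w)"
      by (simp_all add: s monomial_append mult.assoc)
    then have "monomial w * s \<in> ?S" "s * monomial w \<in> ?S" using s(2) by blast+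
    then show ?case
      using step by (simp add: distrib_left distrib_right mult_scale scale_mult
          free_alg.span_add free_alg.span_scale free_alg.span_base)
  qed
  have "x * a \<in> free_alg.span ?S \<and> a * x \<in> free_alg.span ?S"
  proof (induction x rule: free_alg_induct)
    case (single w c)
    show ?case
      unfolding single_eq_scale mult_scale scale_mult using words free_alg.span_scale by blast
  next
    case (add x y)
    then show ?case
      unfolding distrib_left distrib_right using free_alg.span_add by blast
  qed
  then show "x \<otimes>\<^bsub>free_ring\<^esub> a \<in> free_alg.span ?S" "a \<otimes>\<^bsub>free_ring\<^esub> x \<in> free_alg.span ?S"
    by (simp_all add: free_ring_simps)
qed

lemma potential_ideal_subset_span:
  "potential_ideal F \<subseteq>
     free_alg.span {monomial u * left_deriv g F * monomial v | u g v. True}"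
proof -
  let ?G = "{left_deriv GX F, left_deriv GY F}"
  have "potential_ideal F \<subseteq> free_alg.span {monomial u * g * monomial v | u g v. g \<in> ?G}"
    unfolding potential_ideal_def
  proof (rule ring.genideal_minimal[OF ring_free_ring ideal_span_sandwiches], rule subsetI)
    fix g assume "g \<in> ?G"
    then have "monomial [] * g * monomial [] \<in> {monomial u * g * monomial v | u g v. g \<in> ?G}"
      by blast
    then show "g \<in> free_alg.span {monomial u * g * monomial v | u g v. g \<in> ?G}"
      by (simp add: monomial_Nil free_alg.span_base)
  qed
  also have "\<dots> \<subseteq> free_alg.span {monomial u * left_deriv g F * monomial v | u g v. True}"
    by (intro free_alg.span_mono) auto
  finally show ?thesis .
qed

lemma zero_in_degree_filtration: "0 \<in> degree_filtration n"
  by (simp add: degree_filtration_def free_alg.span_zero)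

lemma ideal_subset_closure: "I \<subseteq> ideal_closure I"
  using zero_in_degree_filtration by (force simp: mem_ideal_closure)

section \<open>Dimension of a quotient\<close>

text \<open>
  The dimension of a quotient, measured with the coset scalars, is translated here into statements
  about finite spanning sets modulo the ideal inside the free algebra.
\<close>

lemma coset_eq_iff:
  assumes "ideal I (free_ring :: 'k::field free_alg ring)"
  shows "I +>\<^bsub>free_ring\<^esub> p = I +>\<^bsub>free_ring\<^esub> q \<longleftrightarrow> p - q \<in> I"
proof -
  have c: "I +>\<^bsub>free_ring\<^esub> p = {i + p | i. i \<in> I}" for p
    by (auto simp: a_r_coset_def' free_ring_simps)
  show ?thesis
  proof
    assume "I +>\<^bsub>free_ring\<^esub> p = I +>\<^bsub>free_ring\<^esub> q"
    then have "0 + p \<in> {i + q | i. i \<in> I}" using ideal_closed(1)[OF assms] c by blast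
    then show "p - q \<in> I" by auto
  next
    assume pq: "p - q \<in> I"
    have "i + p = (i + (p - q)) + q" "i + q = (i - (p - q)) + p" for i by simp_all
    then show "I +>\<^bsub>free_ring\<^esub> p = I +>\<^bsub>free_ring\<^esub> q"
      unfolding c using ideal_closed(2,4)[OF assms _ pq] by blast
  qed
qed

lemma carrier_Quot:
  "carrier ((free_ring :: 'k::field free_alg ring) Quot I) = range (\<lambda>p. I +>\<^bsub>free_ring\<^esub> p)"
  by (auto simp: FactRing_def A_RCOSETS_def' free_ring_simps)

lemma Span_range_const:
  "ring.Span (free_ring :: 'k::field free_alg ring) (range const) ps = free_alg.span (set ps)"
proof -
  interpret ring "free_ring :: 'k free_alg ring" by (rule ring_free_ring)
  show ?thesis
  proof (induction ps)
    case Nil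
    show ?case by (simp add: free_ring_simps)
  next
    case (Cons p ps)
    have "Span (range const) (p # ps) = line_extension (range const) p (Span (range const) ps)"
      by simp
    also have "\<dots> = free_alg.span (set (p # ps))"
    proof (rule Set.set_eqI)
      fix x
      have "(\<exists>v\<in>V. x = const c * p + v) \<longleftrightarrow> x - scale c p \<in> V" for c V
        by (auto simp: scale_def intro: bexI[of _ "x - const c * p"])
      then show "x \<in> line_extension (range const) p (Span (range const) ps) \<longleftrightarrow>
          x \<in> free_alg.span (set (p # ps))"
        unfolding Cons.IH line_extension_mem_iff free_ring_simps
        by (auto simp: free_alg.span_insert)
    qed
    finally show ?case .
  qed
qed

lemma Span_Quot:
  assumes "ideal I (free_ring :: 'k::field free_alg ring)"
  shows "ring.Span (free_ring Quot I) (quot_scalars I) (map (\<lambda>p. I +>\<^bsub>free_ring\<^esub> p) ps)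
    = (\<lambda>p. I +>\<^bsub>free_ring\<^esub> p) ` free_alg.span (set ps)"
proof -
  interpret h: ring_hom_ring free_ring "free_ring Quot I" "(+>\<^bsub>free_ring\<^esub>) I"
    by (rule ideal.rcos_ring_hom_ring[OF assms])
  show ?thesis
    using h.Span_hom[of "range const" ps]
    by (simp add: free_ring_simps Span_range_const quot_scalars_def image_image
        del: h.S.Span.simps h.R.Span.simps)
qed

lemma (in ring) dimension_Span_le:
  assumes K: "subfield K R" and "set Us \<subseteq> carrier R"
  shows "\<exists>n\<le>length Us. dimension n K (Span K Us)"
  using assms(2)
proof (induction Us)
  case Nil
  show ?case using zero_dim by auto
next
  case (Cons u Us)
  then obtain n where n: "n \<le> length Us" "dimension n K (Span K Us)" by auto
  show ?case
  proof (cases "u \<in> Span K Us")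
    case True
    then have "Span K (u # Us) = Span K Us"
      using Cons.prems Span_base_incl[OF K] mono_Span_subset[OF K]
      by (metis insert_subset list.simps(15) subset_antisym)
    then show ?thesis using n by (auto intro!: exI[of _ n])
  next
    case False
    then have "dimension (Suc n) K (Span K (u # Us))"
      using Suc_dim[OF _ False n(2)] Cons.prems by simp
    then show ?thesis using n(1) by (metis Suc_le_mono length_Cons)
  qed
qed

lemma ring_dim_Quot_ge:
  fixes I :: "'k::field free_alg set"
  assumes I: "ideal I free_ring" and m: "0 < m"
    and bound: "\<And>S. finite S \<Longrightarrow> (\<And>p. \<exists>q\<in>free_alg.span S. p - q \<in> I) \<Longrightarrow> m \<le> card S"
  shows "enat m \<le> ring_dim (quot_scalars I) (free_ring Quot I)"
proof (cases "ring.finite_dimension (free_ring Quot I) (quot_scalars I) (carrier (free_ring Quot I))")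
  case False
  then show ?thesis by (simp add: ring_dim_def)
next
  case True
  interpret Q: ring "free_ring Quot I" by (rule ideal.quotient_is_ring[OF I])
  have "I \<noteq> UNIV" using bound[of "{}"] m by auto
  then have K: "subfield (quot_scalars I) (free_ring Quot I)" by (rule subfield_quot_scalars[OF I])
  let ?n = "Q.dim (quot_scalars I) (carrier (free_ring Quot I))"
  have "Q.dimension ?n (quot_scalars I) (carrier (free_ring Quot I))"
    using Q.finite_dimensionE[OF K True] by (simp add: over_def)
  then obtain Us where Us: "set Us \<subseteq> carrier (free_ring Quot I)" "length Us = ?n"
    "Q.Span (quot_scalars I) Us = carrier (free_ring Quot I)"
    using Q.exists_base[OF K] by blast
  obtain ps where ps: "Us = map (\<lambda>p. I +>\<^bsub>free_ring\<^esub> p) ps"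
    using Us(1) unfolding carrier_Quot by (metis ex_map_conv rangeE subset_iff)
  have "m \<le> card (set ps)"
  proof (rule bound)
    fix p
    have "I +>\<^bsub>free_ring\<^esub> p \<in> (\<lambda>p. I +>\<^bsub>free_ring\<^esub> p) ` free_alg.span (set ps)"
      using Us(3) unfolding ps Span_Quot[OF I] carrier_Quot by blast
    then show "\<exists>q\<in>free_alg.span (set ps). p - q \<in> I" using coset_eq_iff[OF I] by blast
  qed simp
  also have "\<dots> \<le> ?n" using card_length[of ps] Us(2) ps by simp
  finally show ?thesis using True by (simp add: ring_dim_def)
qed

lemma ring_dim_Quot_le:
  fixes I :: "'k::field free_alg set"
  assumes I: "ideal I free_ring" "I \<noteq> UNIV"
    and spans: "\<And>p. \<exists>q\<in>free_alg.span (set ps). p - q \<in> I"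
  shows "ring_dim (quot_scalars I) (free_ring Quot I) \<le> enat (length ps)"
proof -
  interpret Q: ring "free_ring Quot I" by (rule ideal.quotient_is_ring[OF I(1)])
  have K: "subfield (quot_scalars I) (free_ring Quot I)" by (rule subfield_quot_scalars[OF I])
  let ?Us = "map (\<lambda>p. I +>\<^bsub>free_ring\<^esub> p) ps"
  have Us: "set ?Us \<subseteq> carrier (free_ring Quot I)" by (auto simp: carrier_Quot)
  have S: "Q.Span (quot_scalars I) ?Us = carrier (free_ring Quot I)"
    unfolding Span_Quot[OF I(1)] carrier_Quot using spans coset_eq_iff[OF I(1)] by blast
  obtain n where n: "n \<le> length ?Us" "Q.dimension n (quot_scalars I) (carrier (free_ring Quot I))"
    using Q.dimension_Span_le[OF K Us] S by auto
  then have "Q.finite_dimension (quot_scalars I) (carrier (free_ring Quot I))"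
    "Q.dim (quot_scalars I) (carrier (free_ring Quot I)) = n"
    using Q.finite_dimensionI Q.dimI[OF K] by (auto simp: over_def)
  then show ?thesis using n(1) by (simp add: ring_dim_def)
qed

section \<open>Two functionals in degree four\<close>

text \<open>
  If \<open>a = b = 0\<close>, the first coordinate vector serves. Otherwise the cross product of the two vectors
  does, unless it vanishes; in that case the vectors are dependent with the first one nonzero, and
  \<open>(b, -a, 0)\<close> is orthogonal to the first one and hence to both.
\<close>

lemma common_orthogonal_vector:
  fixes a b c d :: "'k::field"
  shows "\<exists>\<alpha> \<beta> \<gamma>. (\<alpha>, \<beta>, \<gamma>) \<noteq> (0, 0, 0) \<and>
    a * \<alpha> + b * \<beta> + c * \<gamma> = 0 \<and> b * \<alpha> + c * \<beta> + d * \<gamma> = 0"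
proof (cases "a = 0 \<and> b = 0")
  case True
  then show ?thesis by (intro exI[of _ 1] exI[of _ 0]) auto
next
  case False
  show ?thesis
  proof (cases "b * d = c * c \<and> b * c = a * d \<and> a * c = b * b")
    case True
    then show ?thesis
      using False by (intro exI[of _ b] exI[of _ "- a"] exI[of _ 0]) (auto simp: algebra_simps)
  next
    case F: False
    show ?thesis
      using F by (intro exI[of _ "b * d - c * c"] exI[of _ "b * c - a * d"]
          exI[of _ "a * c - b * b"]) (auto simp: algebra_simps)
  qed
qed

text \<open>
  A functional on words of length 4 is sought whose value depends only on the number \<open>i\<close> of letters
  \<open>y\<close> in the odd positions and the number \<open>j\<close> of letters \<open>y\<close> in the even positions; \<open>h i j\<close> is that
  value. If the two letters in adjacent positions are left open and the other two contribute \<open>i\<close> and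
  \<open>j\<close>, the four completions by \<open>xx, xy, yx, yy\<close> have the values \<open>h i j\<close>, \<open>h i (j+1)\<close>, \<open>h (i+1) j\<close>,
  \<open>h (i+1) (j+1)\<close>, with the middle two possibly exchanged. The rule makes these values, after adding
  up the middle ones, a multiple of \<open>(\<alpha>, \<beta>, \<gamma>)\<close>, so that a relation with coefficients \<open>(a, b, b, c)\<close>
  orthogonal to \<open>(\<alpha>, \<beta>, \<gamma>)\<close> is annihilated in every position.
\<close>

definition table_rule :: "'k::field \<Rightarrow> 'k \<Rightarrow> 'k \<Rightarrow> (nat \<Rightarrow> nat \<Rightarrow> 'k) \<Rightarrow> bool" where
  "table_rule \<alpha> \<beta> \<gamma> h \<longleftrightarrow> (\<forall>i\<le>1. \<forall>j\<le>1. \<exists>t.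
     h i j = t * \<alpha> \<and> h i (Suc j) + h (Suc i) j = t * \<beta> \<and> h (Suc i) (Suc j) = t * \<gamma>)"

lemma table_rule_iff:
  "table_rule \<alpha> \<beta> \<gamma> h \<longleftrightarrow> (\<forall>i\<in>{0, 1}. \<forall>j\<in>{0, 1}. \<exists>t.
     h i j = t * \<alpha> \<and> h i (Suc j) + h (Suc i) j = t * \<beta> \<and> h (Suc i) (Suc j) = t * \<gamma>)"
proof -
  have "i \<le> 1 \<longleftrightarrow> i \<in> {0, 1}" for i :: nat by auto
  then show ?thesis by (simp add: table_rule_def Ball_def)
qed

definition table3 :: "'a list list \<Rightarrow> nat \<Rightarrow> nat \<Rightarrow> 'a" where
  "table3 xss i j = xss ! i ! j"

text \<open>
  In the algebra \<open>K[z]/(z\<^sup>2 - \<beta>z + \<gamma>)\<close> let \<open>\<theta>\<close> be the class of \<open>z\<close> and \<open>\<theta>' = \<beta> - \<theta>\<close>, so that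
  \<open>\<theta> + \<theta>' = \<beta>\<close> and \<open>\<theta> \<theta>' = \<gamma>\<close>. The table \<open>\<theta>\<^sup>i \<theta>'\<^sup>j\<close> then satisfies the rule with values in this algebra.
  The entries below are its images under the functional that maps \<open>1\<close> to \<open>s\<close> and \<open>\<theta>\<close> to \<open>t\<close>.
\<close>

lemma table_rule_leading_one:
  "table_rule 1 \<beta> (\<gamma> :: 'k::field) (table3
     [[s, \<beta> * s - t, \<beta> * (\<beta> * s - t) - \<gamma> * s],
      [t, \<gamma> * s, \<gamma> * (\<beta> * s - t)],
      [\<beta> * t - \<gamma> * s, \<gamma> * t, \<gamma> * \<gamma> * s]])"
  unfolding table_rule_iff by (auto simp: table3_def algebra_simps)

lemma table_rule_scale:
  assumes "table_rule \<alpha> \<beta> \<gamma> h" and "k \<noteq> (0 :: 'k::field)"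
  shows "table_rule (k * \<alpha>) (k * \<beta>) (k * \<gamma>) h"
  unfolding table_rule_def
proof (intro allI impI)
  fix i j :: nat assume "i \<le> 1" "j \<le> 1"
  then obtain t where "h i j = t * \<alpha>" "h i (Suc j) + h (Suc i) j = t * \<beta>"
    "h (Suc i) (Suc j) = t * \<gamma>"
    using assms unfolding table_rule_def by blast
  then show "\<exists>t. h i j = t * (k * \<alpha>) \<and> h i (Suc j) + h (Suc i) j = t * (k * \<beta>) \<and>
      h (Suc i) (Suc j) = t * (k * \<gamma>)"
    using assms(2) by (intro exI[of _ "t / k"]) auto
qed

text \<open>The symmetry that exchanges the letters \<open>x\<close> and \<open>y\<close>.\<close>

lemma table_rule_reflect:
  assumes "table_rule \<alpha> \<beta> \<gamma> h"
  shows "table_rule \<gamma> \<beta> \<alpha> (\<lambda>i j. h (2 - i) (2 - j))"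
  using assms unfolding table_rule_iff
  by (auto simp: numeral_2_eq_2 add.commute)

text \<open>
  If \<open>\<alpha> \<noteq> 0\<close>, the parameters \<open>(s, t) = (1, 0)\<close> and \<open>(0, 1)\<close> of the explicit table give the two solutions;
  \<open>\<gamma> \<noteq> 0\<close> is the reflected case. If \<open>\<alpha> = \<gamma> = 0\<close>, the quadratic form is already a product of the two
  coordinates, and the solutions are the indicators of the words \<open>yxyx\<close> and \<open>xyxy\<close>. The entries
  singled out in the conclusion witness linear independence.
\<close>

lemma two_tables:
  fixes \<alpha> \<beta> \<gamma> :: "'k::field"
  assumes "(\<alpha>, \<beta>, \<gamma>) \<noteq> (0, 0, 0)"
  shows "\<exists>h1 h2 i1 j1 i2 j2. table_rule \<alpha> \<beta> \<gamma> h1 \<and> table_rule \<alpha> \<beta> \<gamma> h2 \<and>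
    i1 \<le> 2 \<and> j1 \<le> 2 \<and> i2 \<le> 2 \<and> j2 \<le> 2 \<and>
    h1 i1 j1 = 1 \<and> h1 i2 j2 = 0 \<and> h2 i1 j1 = 0 \<and> h2 i2 j2 = 1"
    (is "?P \<alpha> \<beta> \<gamma>")
proof -
  have leading: "?P \<alpha> \<beta> \<gamma>" if "\<alpha> \<noteq> 0" for \<alpha> \<beta> \<gamma> :: 'k
  proof -
    define h where "h s t = table3 [[s, \<beta>/\<alpha> * s - t, \<beta>/\<alpha> * (\<beta>/\<alpha> * s - t) - \<gamma>/\<alpha> * s],
      [t, \<gamma>/\<alpha> * s, \<gamma>/\<alpha> * (\<beta>/\<alpha> * s - t)],
      [\<beta>/\<alpha> * t - \<gamma>/\<alpha> * s, \<gamma>/\<alpha> * t, \<gamma>/\<alpha> * (\<gamma>/\<alpha>) * s]]" for s t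
    have "table_rule \<alpha> \<beta> \<gamma> (h s t)" for s t
      using table_rule_scale[OF table_rule_leading_one that, of "\<beta>/\<alpha>" "\<gamma>/\<alpha>" s t] that
      by (simp add: h_def)
    moreover have "h 1 0 0 0 = 1" "h 1 0 1 0 = 0" "h 0 1 0 0 = 0" "h 0 1 1 0 = 1"
      by (simp_all add: h_def table3_def)
    ultimately show ?thesis
      by (intro exI[of _ "h 1 0"] exI[of _ "h 0 1"] exI[of _ "0::nat"] exI[of _ "1::nat"]) auto
  qed
  show ?thesis
  proof (cases "\<alpha> = 0 \<and> \<gamma> = 0")
    case True
    let ?h1 = "table3 [[0, 0, 0], [0, 0, 0], [1, 0, 0 :: 'k]]"
    let ?h2 = "table3 [[0, 0, 1], [0, 0, 0], [0, 0, 0 :: 'k]]"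
    have "\<exists>t. 1 = t * \<beta>" using True assms by (auto intro: exI[of _ "1 / \<beta>"])
    then have "table_rule \<alpha> \<beta> \<gamma> ?h1" "table_rule \<alpha> \<beta> \<gamma> ?h2"
      using True unfolding table_rule_iff by (auto simp: table3_def)
    then show ?thesis
      by (intro exI[of _ ?h1] exI[of _ ?h2] exI[of _ "2::nat"] exI[of _ "0::nat"])
        (auto simp: table3_def)
  next
    case False
    show ?thesis
    proof (cases "\<alpha> = 0")
      case \<alpha>: True
      then have "\<gamma> \<noteq> 0" using False by simp
      from leading[OF this, of \<beta> \<alpha>] obtain h1 h2 i1 j1 i2 j2 where
        "table_rule \<gamma> \<beta> \<alpha> h1" "table_rule \<gamma> \<beta> \<alpha> h2" and
        le: "i1 \<le> 2" "j1 \<le> 2" "i2 \<le> 2" "j2 \<le> 2" and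
        h: "h1 i1 j1 = 1" "h1 i2 j2 = 0" "h2 i1 j1 = 0" "h2 i2 j2 = 1" by metis
      then have "table_rule \<alpha> \<beta> \<gamma> (\<lambda>i j. h1 (2 - i) (2 - j))"
        "table_rule \<alpha> \<beta> \<gamma> (\<lambda>i j. h2 (2 - i) (2 - j))"
        by (auto intro: table_rule_reflect)
      then show ?thesis
        by (intro exI[of _ "\<lambda>i j. h1 (2 - i) (2 - j)"] exI[of _ "\<lambda>i j. h2 (2 - i) (2 - j)"]
            exI[of _ "2 - i1"] exI[of _ "2 - j1"] exI[of _ "2 - i2"] exI[of _ "2 - j2"])
          (simp add: le h)
    qed (rule leading)
  qed
qed

fun degree_Y :: "gen \<Rightarrow> nat" where
  "degree_Y GX = 0"
| "degree_Y GY = 1"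

fun table_functional :: "(nat \<Rightarrow> nat \<Rightarrow> 'k) \<Rightarrow> gen list \<Rightarrow> 'k::zero" where
  "table_functional h [g1, g2, g3, g4] = h (degree_Y g1 + degree_Y g3) (degree_Y g2 + degree_Y g4)"
| "table_functional h _ = 0"

text \<open>
  The functional vanishes on all products of degree 4 of words with the symmetric quadratic element
  \<open>a xx + b xy + b yx + c yy\<close>.
\<close>

definition contracts_to_zero :: "'k::field \<Rightarrow> 'k \<Rightarrow> 'k \<Rightarrow> (gen list \<Rightarrow> 'k) \<Rightarrow> bool" where
  "contracts_to_zero a b c f \<longleftrightarrow> (\<forall>u v. length u + length v = 2 \<longrightarrow>
     a * f (u @ [GX, GX] @ v) + b * f (u @ [GX, GY] @ v) + b * f (u @ [GY, GX] @ v) +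
     c * f (u @ [GY, GY] @ v) = 0)"

lemma contracts_to_zero_table_functional:
  fixes h :: "nat \<Rightarrow> nat \<Rightarrow> 'k::field"
  assumes rule: "table_rule \<alpha> \<beta> \<gamma> h" and orth: "a * \<alpha> + b * \<beta> + c * \<gamma> = 0"
  shows "contracts_to_zero a b c (table_functional h)"
  unfolding contracts_to_zero_def
proof (intro allI impI)
  fix u v :: "gen list" assume "length u + length v = 2"
  have *: "a * h i j + b * h i (Suc j) + b * h (Suc i) j + c * h (Suc i) (Suc j) = 0"
    "a * h i j + b * h (Suc i) j + b * h i (Suc j) + c * h (Suc i) (Suc j) = 0"
    if ij: "i \<le> 1" "j \<le> 1" for i j
  proof -
    obtain t where t: "h i j = t * \<alpha>" "h i (Suc j) + h (Suc i) j = t * \<beta>"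
      "h (Suc i) (Suc j) = t * \<gamma>"
      using rule ij unfolding table_rule_def by blast
    have "a * h i j + b * (h i (Suc j) + h (Suc i) j) + c * h (Suc i) (Suc j)
        = t * (a * \<alpha> + b * \<beta> + c * \<gamma>)"
      unfolding t by (simp add: algebra_simps)
    also have "\<dots> = 0" using orth by simp
    finally show "a * h i j + b * h i (Suc j) + b * h (Suc i) j + c * h (Suc i) (Suc j) = 0"
      "a * h i j + b * h (Suc i) j + b * h i (Suc j) + c * h (Suc i) (Suc j) = 0"
      by (simp_all add: algebra_simps)
  qed
  have d: "degree_Y g \<le> 1" for g by (cases g) auto
  consider (left) x y where "u = [x, y]" "v = []" | (mid) x y where "u = [x]" "v = [y]"
    | (right) x y where "u = []" "v = [x, y]"
    using \<open>length u + length v = 2\<close>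
    by (cases u rule: remdups_adj.cases; cases v rule: remdups_adj.cases) auto
  then show "a * table_functional h (u @ [GX, GX] @ v) + b * table_functional h (u @ [GX, GY] @ v)
      + b * table_functional h (u @ [GY, GX] @ v) + c * table_functional h (u @ [GY, GY] @ v) = 0"
    by cases (simp_all add: *[OF d d])
qed

lemma word_with_table_entry:
  assumes "i \<le> 2" "j \<le> 2"
  shows "\<exists>w. length w = 4 \<and> (\<forall>h. table_functional h w = h i j)"
proof -
  have split: "\<exists>x y. n = degree_Y x + degree_Y y" if "n \<le> 2" for n
  proof -
    have "n = degree_Y GX + degree_Y GX \<or> n = degree_Y GX + degree_Y GY \<or>
        n = degree_Y GY + degree_Y GY"
      using that by auto
    then show ?thesis by blast
  qed
  obtain x1 x2 y1 y2 where "i = degree_Y x1 + degree_Y x2" "j = degree_Y y1 + degree_Y y2"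
    using split[OF assms(1)] split[OF assms(2)] by blast
  then show ?thesis by (intro exI[of _ "[x1, y1, x2, y2]"]) auto
qed

lemma two_contracted_functionals:
  fixes a b c d :: "'k::field"
  obtains f1 f2 w1 w2 where
    "contracts_to_zero a b c f1" "contracts_to_zero b c d f1"
    "contracts_to_zero a b c f2" "contracts_to_zero b c d f2"
    "length w1 = 4" "length w2 = 4"
    "f1 w1 = 1" "f1 w2 = 0" "f2 w1 = 0" "f2 w2 = 1"
proof -
  obtain \<alpha> \<beta> \<gamma> where nz: "(\<alpha>, \<beta>, \<gamma>) \<noteq> (0, 0, 0)"
    and orth: "a * \<alpha> + b * \<beta> + c * \<gamma> = 0" "b * \<alpha> + c * \<beta> + d * \<gamma> = 0"
    using common_orthogonal_vector[of a b c d] by metis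
  obtain h1 h2 i1 j1 i2 j2 where
    t: "table_rule \<alpha> \<beta> \<gamma> h1" "table_rule \<alpha> \<beta> \<gamma> h2" and
    le: "i1 \<le> 2" "j1 \<le> 2" "i2 \<le> 2" "j2 \<le> 2" and
    h: "h1 i1 j1 = 1" "h1 i2 j2 = 0" "h2 i1 j1 = 0" "h2 i2 j2 = 1"
    using two_tables[OF nz] by metis
  obtain w1 where w1: "length w1 = 4" "\<And>h :: nat \<Rightarrow> nat \<Rightarrow> 'k. table_functional h w1 = h i1 j1"
    using word_with_table_entry[OF le(1,2)] by blast
  obtain w2 where w2: "length w2 = 4" "\<And>h :: nat \<Rightarrow> nat \<Rightarrow> 'k. table_functional h w2 = h i2 j2"
    using word_with_table_entry[OF le(3,4)] by blast
  show thesis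
    by (rule that[of "table_functional h1" "table_functional h2" w1 w2])
      (use t orth in \<open>auto intro: contracts_to_zero_table_functional simp: w1 w2 h\<close>)
qed

section \<open>The lower bound\<close>

lemma inj_monomial: "inj (monomial :: gen list \<Rightarrow> 'k::field free_alg)"
proof (rule injI)
  fix v w assume "monomial v = (monomial w :: 'k free_alg)"
  then have "Poly_Mapping.lookup (monomial v) v = (Poly_Mapping.lookup (monomial w) v :: 'k)"
    by simp
  then show "v = w"
    by (simp add: monomial_def Poly_Mapping.lookup_single when_def split: if_splits)
qed

lemma independent_monomials: "free_alg.independent (monomial ` W :: 'k::field free_alg set)"
  unfolding free_alg.independent_explicit_finite_subsets
proof (intro allI impI ballI)
  fix S and u :: "'k free_alg \<Rightarrow> 'k" and p :: "'k free_alg"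
  assume S: "S \<subseteq> monomial ` W" "finite S" and sum: "(\<Sum>q\<in>S. scale (u q) q) = 0" and p: "p \<in> S"
  obtain w where w: "p = monomial w" using S p by auto
  have "(\<Sum>q\<in>S. u q * Poly_Mapping.lookup q w) = u p * Poly_Mapping.lookup p w"
  proof -
    have "Poly_Mapping.lookup q w = 0" if q: "q \<in> S - {p}" for q
    proof -
      obtain v where "q = monomial v" using q S by auto
      then show ?thesis
        using q w by (auto simp: monomial_def Poly_Mapping.lookup_single when_def)
    qed
    then show ?thesis using S(2) p by (simp add: sum.remove)
  qed
  moreover have "(\<Sum>q\<in>S. u q * Poly_Mapping.lookup q w) = 0"
    using arg_cong[OF sum, of "\<lambda>x. Poly_Mapping.lookup x w"]
    by (simp add: Poly_Mapping.lookup_sum lookup_scale)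
  ultimately show "u p = 0" by (simp add: w monomial_def)
qed

lemma UNIV_gen: "(UNIV :: gen set) = {GX, GY}"
  using gen.exhaust by auto

lemma card_words_le_3: "card {w :: gen list. length w \<le> 3} = 15" "finite {w :: gen list. length w \<le> 3}"
proof -
  have "finite (UNIV :: gen set)" "card (UNIV :: gen set) = 2" by (simp_all add: UNIV_gen)
  then show "card {w :: gen list. length w \<le> 3} = 15" "finite {w :: gen list. length w \<le> 3}"
    using card_lists_length_le[of "UNIV :: gen set" 3] finite_lists_length_le[of "UNIV :: gen set" 3]
    by (simp_all add: numeral_eq_Suc)
qed

lemma potential_cubic_coefficients:
  assumes "potential F"
  shows "Poly_Mapping.lookup F [GX, GY, GX] = Poly_Mapping.lookup F [GX, GX, GY]"
    "Poly_Mapping.lookup F [GY, GX, GX] = Poly_Mapping.lookup F [GX, GX, GY]"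
    "Poly_Mapping.lookup F [GY, GX, GY] = Poly_Mapping.lookup F [GX, GY, GY]"
    "Poly_Mapping.lookup F [GY, GY, GX] = Poly_Mapping.lookup F [GX, GY, GY]"
  using potential_rotate[OF assms, of "[GX, GY]" GX] potential_rotate[OF assms, of "[GY, GX]" GX]
    potential_rotate[OF assms, of "[GY, GX]" GY] potential_rotate[OF assms, of "[GY, GY]" GX]
    potential_rotate[OF assms, of "[GX, GY]" GY]
  by simp_all

text \<open>
  For an element without terms of degree below 2, a linear map that vanishes from degree 3 on sees
  nothing but the quadratic part.
\<close>

lemma linear_ext_quadratic_part:
  assumes "\<And>w. w \<in> Poly_Mapping.keys p \<Longrightarrow> 2 \<le> length w" "\<And>w. 3 \<le> length w \<Longrightarrow> t w = 0"
  shows "linear_ext t p =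
    scale (Poly_Mapping.lookup p [GX, GX]) (t [GX, GX]) + scale (Poly_Mapping.lookup p [GX, GY]) (t [GX, GY]) +
    scale (Poly_Mapping.lookup p [GY, GX]) (t [GY, GX]) + scale (Poly_Mapping.lookup p [GY, GY]) (t [GY, GY])"
proof -
  let ?Q = "{[GX, GX], [GX, GY], [GY, GX], [GY, GY]}"
  have Q: "w \<in> ?Q" if len: "length w = 2" for w
  proof -
    obtain x y where "w = [x, y]" using len by (auto simp: length_Suc_conv numeral_2_eq_2)
    then show ?thesis by (cases x; cases y) auto
  qed
  have "linear_ext t p
      = (\<Sum>w\<in>Poly_Mapping.keys p \<union> ?Q. scale (Poly_Mapping.lookup p w) (t w))"
    by (intro linear_ext_superset) auto
  also have "\<dots> = (\<Sum>w\<in>?Q. scale (Poly_Mapping.lookup p w) (t w))"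
  proof (rule sum.mono_neutral_right)
    show "\<forall>w\<in>Poly_Mapping.keys p \<union> ?Q - ?Q. scale (Poly_Mapping.lookup p w) (t w) = 0"
    proof
      fix w assume w: "w \<in> Poly_Mapping.keys p \<union> ?Q - ?Q"
      then have "length w \<noteq> 2" "2 \<le> length w" using Q assms(1) by blast+
      then show "scale (Poly_Mapping.lookup p w) (t w) = 0" using assms(2)[of w] by simp
    qed
  qed auto
  finally show ?thesis by (simp add: add.assoc)
qed

text \<open>
  The count is carried out through an endomorphism \<open>T\<close> of the free algebra that is the identity in
  degrees at most 3, applies the two functionals in degree 4 with two words \<open>w1\<close>, \<open>w2\<close> marking their
  values, and vanishes in higher degrees. The image of \<open>T\<close> contains 17 independent monomials, whereas
  \<open>T\<close> maps the closure of the ideal into a span of 9 elements. A spanning set modulo the closure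
  must therefore supply the other 8 dimensions.
\<close>

lemma card_spanning_set_modulo_closure:
  fixes F :: "'k::field free_alg"
  assumes pot: "potential F" and deg: "terms_degree_ge 3 F" and S: "finite S"
    and spans: "\<And>p. \<exists>q\<in>free_alg.span S. p - q \<in> ideal_closure (potential_ideal F)"
  shows "8 \<le> card S"
proof -
  let ?a = "Poly_Mapping.lookup F [GX, GX, GX]" and ?b = "Poly_Mapping.lookup F [GX, GX, GY]"
    and ?c = "Poly_Mapping.lookup F [GX, GY, GY]" and ?d = "Poly_Mapping.lookup F [GY, GY, GY]"
  obtain f1 f2 w1 w2 where f:
    "contracts_to_zero ?a ?b ?c f1" "contracts_to_zero ?b ?c ?d f1"
    "contracts_to_zero ?a ?b ?c f2" "contracts_to_zero ?b ?c ?d f2"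
    and w: "length w1 = 4" "length w2 = 4"
    and fw: "f1 w1 = 1" "f1 w2 = 0" "f2 w1 = 0" "f2 w2 = 1"
    using two_contracted_functionals by blast
  define t :: "gen list \<Rightarrow> 'k free_alg" where
    "t w = (if length w \<le> 3 then monomial w
      else if length w = 4 then scale (f1 w) (monomial w1) + scale (f2 w) (monomial w2) else 0)" for w
  define T where "T = linear_ext t"
  interpret T: module_hom scale scale T unfolding T_def by (rule module_hom_linear_ext)
  let ?D = "\<lambda>g. left_deriv g F"

  have keys: "2 \<le> length w" if "w \<in> Poly_Mapping.keys (?D g)" for g w
  proof -
    have "g # w \<in> Poly_Mapping.keys F"
      using that by (simp add: Poly_Mapping.in_keys_iff lookup_left_deriv)
    then show ?thesis using deg by (fastforce simp: terms_degree_ge_def)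
  qed
  have kill: "T (monomial u * ?D g * monomial v) = 0" if uv: "2 \<le> length u + length v" for u g v
  proof (cases "length u + length v = 2")
    case False
    have "t (u @ w @ v) = 0" if "w \<in> Poly_Mapping.keys (?D g)" for w
      using keys[OF that] uv False by (simp add: t_def)
    then show ?thesis unfolding T_def linear_ext_sandwich by (simp add: linear_ext_def)
  next
    case True
    let ?L = "\<lambda>f :: gen list \<Rightarrow> 'k. Poly_Mapping.lookup (?D g) [GX, GX] * f (u @ [GX, GX] @ v) +
        Poly_Mapping.lookup (?D g) [GX, GY] * f (u @ [GX, GY] @ v) +
        Poly_Mapping.lookup (?D g) [GY, GX] * f (u @ [GY, GX] @ v) +
        Poly_Mapping.lookup (?D g) [GY, GY] * f (u @ [GY, GY] @ v)"
    have t4: "t (u @ [x, y] @ v) = scale (f1 (u @ [x, y] @ v)) (monomial w1)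
        + scale (f2 (u @ [x, y] @ v)) (monomial w2)" for x y
      using True by (simp add: t_def)
    have "T (monomial u * ?D g * monomial v) = linear_ext (\<lambda>w. t (u @ w @ v)) (?D g)"
      by (simp add: T_def linear_ext_sandwich)
    also have "\<dots> = scale (Poly_Mapping.lookup (?D g) [GX, GX]) (t (u @ [GX, GX] @ v)) +
        scale (Poly_Mapping.lookup (?D g) [GX, GY]) (t (u @ [GX, GY] @ v)) +
        scale (Poly_Mapping.lookup (?D g) [GY, GX]) (t (u @ [GY, GX] @ v)) +
        scale (Poly_Mapping.lookup (?D g) [GY, GY]) (t (u @ [GY, GY] @ v))"
      by (rule linear_ext_quadratic_part[where t = "\<lambda>w. t (u @ w @ v)"])
        (use keys True in \<open>auto simp: t_def\<close>)
    also have "\<dots> = scale (?L f1) (monomial w1) + scale (?L f2) (monomial w2)"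
      unfolding t4
      by (simp only: free_alg.scale_right_distrib free_alg.scale_left_distrib
          free_alg.scale_scale add_ac)
    also have "\<dots> = 0"
    proof -
      have "?L f1 = 0" "?L f2 = 0"
        using f True potential_cubic_coefficients[OF pot]
        by (cases g; simp add: contracts_to_zero_def lookup_left_deriv)+
      then show ?thesis by simp
    qed
    finally show ?thesis .
  qed

  \<comment> \<open>The product of \<open>y\<close> with \<open>\<partial>\<^sub>yF\<close> is left out: the syzygy expresses it by three of the others.\<close>
  define rs where "rs = [?D GX, ?D GY,
    monomial [GX] * ?D GX, ?D GX * monomial [GX], monomial [GY] * ?D GX, ?D GX * monomial [GY],
    monomial [GX] * ?D GY, ?D GY * monomial [GX], ?D GY * monomial [GY]]"
  let ?V = "free_alg.span (T ` set rs)"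
  have rs: "T r \<in> ?V" if "r \<in> set rs" for r
    using that by (simp add: free_alg.span_base)
  have gen: "T (monomial u * ?D g * monomial v) \<in> ?V" for u g v
  proof (cases "2 \<le> length u + length v")
    case True
    then show ?thesis by (simp add: kill free_alg.span_zero)
  next
    case False
    have syz: "T (monomial [GY] * ?D GY) =
        T (?D GX * monomial [GX]) + T (?D GY * monomial [GY]) - T (monomial [GX] * ?D GX)"
      using arg_cong[OF potential_syzygy[OF pot], of T] by (simp add: T.add eq_diff_eq add.commute)
    have YY: "T (monomial [GY] * ?D GY) \<in> ?V"
      unfolding syz by (intro free_alg.span_diff free_alg.span_add rs) (simp_all add: rs_def)
    consider "u = []" "v = []" | z where "u = [z]" "v = []" | z where "u = []" "v = [z]"
      using False by (cases u; cases v) (auto simp: Suc_le_eq)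
    then show ?thesis
    proof cases
      case 1
      then show ?thesis using rs[of "?D g"] by (cases g) (simp_all add: rs_def monomial_Nil)
    next
      case 2
      then show ?thesis using rs[of "monomial [z] * ?D g"] YY
        by (cases g; cases z) (simp_all add: rs_def monomial_Nil)
    next
      case 3
      then show ?thesis using rs[of "?D g * monomial [z]"]
        by (cases g; cases z) (simp_all add: rs_def monomial_Nil)
    qed
  qed
  have ideal: "T p \<in> ?V" if "p \<in> potential_ideal F" for p
  proof -
    let ?G = "{monomial u * ?D g * monomial v | u g v. True}"
    have "T p \<in> T ` free_alg.span ?G" using that potential_ideal_subset_span by blast
    also have "\<dots> = free_alg.span (T ` ?G)" by (rule T.span_image[symmetric])
    also have "\<dots> \<subseteq> ?V"
      using gen by (intro free_alg.span_minimal free_alg.subspace_span) auto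
    finally show ?thesis .
  qed
  have filtration: "T p = 0" if "p \<in> degree_filtration 5" for p
  proof -
    have long: "T (monomial w) = 0" if "5 \<le> length w" for w
      using that by (simp add: T_def linear_ext_monomial t_def)
    show ?thesis
      using that unfolding degree_filtration_def
      by (induction p rule: free_alg.span_induct_alt) (auto simp: T.add T.scale T.zero long)
  qed
  have closure: "T p \<in> ?V" if "p \<in> ideal_closure (potential_ideal F)" for p
  proof -
    obtain a b where "a \<in> potential_ideal F" "b \<in> degree_filtration 5" "p = a + b"
      using \<open>p \<in> _\<close> unfolding mem_ideal_closure by blast
    then show ?thesis by (simp add: T.add filtration ideal)
  qed
  have range: "T p \<in> free_alg.span (T ` S \<union> T ` set rs)" for p
  proof -
    obtain q where q: "q \<in> free_alg.span S" "p - q \<in> ideal_closure (potential_ideal F)"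
      using spans by blast
    have "T q \<in> free_alg.span (T ` S)" using q(1) by (simp add: T.span_image)
    moreover have "T p = T q + T (p - q)" by (simp add: T.diff)
    ultimately show ?thesis using closure[OF q(2)] unfolding free_alg.span_Un by blast
  qed

  let ?B = "{w. length w \<le> 3} \<union> {w1, w2}"
  have fixed: "T (monomial w) = monomial w" if "w \<in> ?B" for w
    using that w fw by (auto simp: T_def linear_ext_monomial t_def)
  then have sub: "monomial ` ?B \<subseteq> free_alg.span (T ` S \<union> T ` set rs)"
    using range by (metis (no_types, lifting) image_subsetI)
  have "finite (T ` S \<union> T ` set rs)" using S by simp
  then have "card (monomial ` ?B :: 'k free_alg set) \<le> card (T ` S \<union> T ` set rs)"
    by (rule conjunct2[OF free_alg.independent_span_bound[OF _ independent_monomials sub]])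
  moreover have "card (monomial ` ?B :: 'k free_alg set) = 17"
  proof -
    have "card (monomial ` ?B :: 'k free_alg set) = card ?B"
      by (intro card_image inj_on_subset[OF inj_monomial subset_UNIV])
    also have "\<dots> = card {w :: gen list. length w \<le> 3} + card {w1, w2}"
      using w by (intro card_Un_disjoint card_words_le_3) auto
    also have "card {w1, w2} = 2" using fw by (auto simp: card_insert_if)
    finally show ?thesis by (simp add: card_words_le_3)
  qed
  moreover have "card (T ` S \<union> T ` set rs) \<le> card S + 9"
  proof -
    have "card (T ` set rs) \<le> card (set rs)" by (simp add: card_image_le)
    also have "\<dots> \<le> 9" using card_length[of rs] by (simp add: rs_def)
    finally show ?thesis
      using card_Un_le[of "T ` S" "T ` set rs"] card_image_le[OF S, of T] by linarith
  qed
  ultimately show ?thesis by linarith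
qed

lemma dim_completion_ge_8:
  fixes F :: "'k::field free_alg"
  assumes "potential F" "terms_degree_ge 3 F"
  shows "8 \<le> dim_completion F"
proof -
  have "enat 8 \<le> dim_completion F"
    unfolding dim_completion_def completed_potential_algebra_def
    by (rule ring_dim_Quot_ge[OF ideal_ideal_closure[OF ideal_potential_ideal]])
      (use card_spanning_set_modulo_closure[OF assms] in auto)
  then show ?thesis by (simp add: numeral_eq_enat)
qed

lemma dim_potential_algebra_ge_8:
  fixes F :: "'k::field free_alg"
  assumes "potential F" "terms_degree_ge 3 F"
  shows "8 \<le> dim_potential_algebra F"
proof -
  have "enat 8 \<le> dim_potential_algebra F"
    unfolding dim_potential_algebra_def potential_algebra_def
  proof (rule ring_dim_Quot_ge[OF ideal_potential_ideal])
    fix S :: "'k free_alg set"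
    assume S: "finite S" and spans: "\<And>p. \<exists>q\<in>free_alg.span S. p - q \<in> potential_ideal F"
    show "8 \<le> card S"
    proof (rule card_spanning_set_modulo_closure[OF assms S])
      fix p
      from spans[of p] show "\<exists>q\<in>free_alg.span S. p - q \<in> ideal_closure (potential_ideal F)"
        using subsetD[OF ideal_subset_closure] by (elim bexE, intro bexI) auto
    qed
  qed simp
  then show ?thesis by (simp add: numeral_eq_enat)
qed

section \<open>A potential whose completed algebra has dimension eight\<close>

definition extremal_potential :: "'k::field free_alg" where
  "extremal_potential = monomial [GX, GX, GX] + monomial [GY, GY, GY] +
     monomial [GX, GY, GX, GY] + monomial [GY, GX, GY, GX]"

lemma potential_extremal: "potential extremal_potential"
  by (simp add: potential_def extremal_potential_def cyc_def linear_ext_add linear_ext_monomial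
      add_ac)

lemma keys_monomial: "Poly_Mapping.keys (monomial w :: 'k::field free_alg) = {w}"
  by (simp add: monomial_def)

lemma terms_degree_ge_extremal: "terms_degree_ge 3 (extremal_potential :: 'k::field free_alg)"
proof -
  have "terms_degree_ge 3 (p + q)" if "terms_degree_ge 3 p" "terms_degree_ge 3 q"
    for p q :: "'k free_alg"
    using that Poly_Mapping.keys_add[of p q] by (auto simp: terms_degree_ge_def)
  moreover have "terms_degree_ge 3 (monomial w :: 'k free_alg)" if "3 \<le> length w" for w
    using that by (simp add: terms_degree_ge_def keys_monomial)
  ultimately show ?thesis by (simp add: extremal_potential_def)
qed

lemma left_deriv_extremal:
  "left_deriv GX extremal_potential = monomial [GX, GX] + monomial [GY, GX, GY]"
  "left_deriv GY extremal_potential = monomial [GY, GY] + monomial [GX, GY, GX]"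
  by (simp_all add: extremal_potential_def left_deriv_def linear_ext_add linear_ext_monomial)

abbreviation extremal_ideal :: "'k::field free_alg set" where
  "extremal_ideal \<equiv> potential_ideal extremal_potential"

lemma sandwich_in_potential_ideal:
  "p \<in> potential_ideal F \<Longrightarrow> monomial u * p * monomial v \<in> potential_ideal F"
  by (intro ideal_closed[OF ideal_potential_ideal])

text \<open>
  The relations \<open>xx = - yxy\<close> and \<open>yy = - xyx\<close> trade a repeated letter for one more unit of length.
\<close>

lemma double_letter_reduces:
  "\<exists>w'. length w' = length (u @ [g, g] @ v) + 1 \<and>
     monomial (u @ [g, g] @ v) + monomial w' \<in> (extremal_ideal :: 'k::field free_alg set)"
proof (cases g)
  case GX
  have "monomial u * (monomial [GX, GX] + monomial [GY, GX, GY]) * monomial v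
      \<in> (extremal_ideal :: 'k free_alg set)"
    using left_deriv_in_potential_ideal[of GX extremal_potential]
    by (intro sandwich_in_potential_ideal) (simp add: left_deriv_extremal)
  then show ?thesis
    unfolding GX by (intro exI[of _ "u @ [GY, GX, GY] @ v"])
      (simp add: distrib_left distrib_right flip: monomial_append)
next
  case GY
  have "monomial u * (monomial [GY, GY] + monomial [GX, GY, GX]) * monomial v
      \<in> (extremal_ideal :: 'k free_alg set)"
    using left_deriv_in_potential_ideal[of GY extremal_potential]
    by (intro sandwich_in_potential_ideal) (simp add: left_deriv_extremal)
  then show ?thesis
    unfolding GY by (intro exI[of _ "u @ [GX, GY, GX] @ v"])
      (simp add: distrib_left distrib_right flip: monomial_append)
qed

text \<open>
  With \<open>r = xx + yxy\<close>, the cubic terms of \<open>x r\<close> and \<open>r x\<close> coincide, so that \<open>x r - r x = xyxy - yxyx\<close>.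
\<close>

lemma alternating_words_congruent:
  "monomial (u @ [GX, GY, GX, GY] @ v) - monomial (u @ [GY, GX, GY, GX] @ v)
     \<in> (extremal_ideal :: 'k::field free_alg set)"
proof -
  let ?r = "left_deriv GX extremal_potential :: 'k free_alg"
  have r: "?r \<in> extremal_ideal" by (rule left_deriv_in_potential_ideal)
  have "monomial [GX] * ?r - ?r * monomial [GX] =
      monomial [GX, GY, GX, GY] - monomial [GY, GX, GY, GX]"
    by (simp add: left_deriv_extremal distrib_left distrib_right flip: monomial_append)
  then have "monomial [GX, GY, GX, GY] - monomial [GY, GX, GY, GX]
      \<in> (extremal_ideal :: 'k free_alg set)"
    using ideal_closed[OF ideal_potential_ideal] r by metis
  from sandwich_in_potential_ideal[OF this, of u v] show ?thesis
    by (simp add: left_diff_distrib right_diff_distrib flip: monomial_append)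
qed

lemma not_distinct_adj_split: "\<not> distinct_adj w \<Longrightarrow> \<exists>u g v. w = u @ [g, g] @ v"
proof (induction w rule: remdups_adj.induct)
  case (3 x y w)
  show ?case
  proof (cases "x = y")
    case True
    then show ?thesis by (intro exI[of _ "[]"]) auto
  next
    case False
    then obtain u g v where "y # w = u @ [g, g] @ v" using 3 by auto
    then show ?thesis by (intro exI[of _ "x # u"]) auto
  qed
qed auto

text \<open>
  Only a word in which no letter is immediately repeated needs an argument; it begins with \<open>xyxyx\<close> or \<open>yxyxy\<close>. The congruence of \<open>xyxy\<close> and \<open>yxyx\<close>
  replaces it by a word of the same length that begins with a repeated letter.
\<close>

lemma long_word_reduces:
  assumes "5 \<le> length w"
  shows "\<exists>w'. length w' = length w + 1 \<and> monomial w + monomial w' \<in> (extremal_ideal :: 'k::field free_alg set)"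
proof (cases "distinct_adj w")
  case False
  then show ?thesis using not_distinct_adj_split double_letter_reduces by blast
next
  case True
  note I = ideal_closed[OF ideal_potential_ideal]
  obtain g1 g2 g3 g4 g5 v where "w = g1 # g2 # g3 # g4 # g5 # v"
    using assms by (auto simp: numeral_eq_Suc Suc_le_length_iff)
  then consider "w = [GX, GY, GX, GY, GX] @ v" | "w = [GY, GX, GY, GX, GY] @ v"
    using True by (cases g1; cases g2; cases g3; cases g4; cases g5) auto
  then show ?thesis
  proof cases
    case 1
    obtain w' where w': "length w' = length w + 1"
      "monomial ([] @ [GX, GX] @ [GY, GX, GY] @ v) + monomial w' \<in> (extremal_ideal :: 'k free_alg set)"
      using double_letter_reduces[of "[]" GX "[GY, GX, GY] @ v"] 1 by auto
    have "(monomial ([] @ [GX, GX] @ [GY, GX, GY] @ v) + monomial w')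
        - (monomial ([GX] @ [GX, GY, GX, GY] @ v) - monomial ([GX] @ [GY, GX, GY, GX] @ v))
        \<in> (extremal_ideal :: 'k free_alg set)"
      by (intro I w' alternating_words_congruent)
    then show ?thesis using 1 w'(1) by (intro exI[of _ w']) (simp add: add.commute)
  next
    case 2
    obtain w' where w': "length w' = length w + 1"
      "monomial ([] @ [GY, GY] @ [GX, GY, GX] @ v) + monomial w' \<in> (extremal_ideal :: 'k free_alg set)"
      using double_letter_reduces[of "[]" GY "[GX, GY, GX] @ v"] 2 by auto
    have "(monomial ([] @ [GY, GY] @ [GX, GY, GX] @ v) + monomial w')
        + (monomial ([GY] @ [GX, GY, GX, GY] @ v) - monomial ([GY] @ [GY, GX, GY, GX] @ v))
        \<in> (extremal_ideal :: 'k free_alg set)"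
      by (intro I w' alternating_words_congruent)
    then show ?thesis using 2 w'(1) by (intro exI[of _ w']) (simp add: add.commute)
  qed
qed

lemma monomial_in_degree_filtration:
  "n \<le> length w \<Longrightarrow> monomial w \<in> degree_filtration n"
  by (simp add: degree_filtration_def free_alg.span_base)

text \<open>
  Iterating the reduction pushes a word of length at least 5 into arbitrarily high degree modulo the
  ideal.
\<close>

lemma long_word_in_closure:
  assumes "5 \<le> length w"
  shows "monomial w \<in> (ideal_closure extremal_ideal :: 'k::field free_alg set)"
  unfolding mem_ideal_closure
proof
  fix n
  note I = ideal_closed[OF ideal_potential_ideal]
  note D = free_alg.span_neg[of _ "monomial ` {w. n \<le> length w}" for n, folded degree_filtration_def]
  have "\<exists>a\<in>extremal_ideal. \<exists>b\<in>degree_filtration (length w + k). monomial w = a + (b :: 'k free_alg)" for k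
    using assms
  proof (induction k arbitrary: w)
    case 0
    then show ?case
      using I(1) monomial_in_degree_filtration by (metis add.right_neutral add_0 order_refl)
  next
    case (Suc k)
    obtain w' where w': "length w' = length w + 1"
      "monomial w + monomial w' \<in> (extremal_ideal :: 'k free_alg set)"
      using long_word_reduces[OF Suc.prems] by blast
    obtain a b where ab: "a \<in> extremal_ideal" "b \<in> degree_filtration (length w' + k)"
      "monomial w' = a + (b :: 'k free_alg)"
      using Suc.IH[of w'] Suc.prems w'(1) by auto
    have "monomial w = (monomial w + monomial w' - a) + (- b)" using ab(3) by simp
    moreover have "- b \<in> degree_filtration (length w + Suc k)" using D[OF ab(2)] w'(1) by simp
    moreover have "monomial w + monomial w' - a \<in> extremal_ideal" using I w'(2) ab(1) by blast
    ultimately show ?case by blast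
  qed
  from this[of n] obtain a b where ab: "a \<in> extremal_ideal" "b \<in> degree_filtration (length w + n)"
    "monomial w = a + (b :: 'k free_alg)" by blast
  have "degree_filtration (length w + n) \<subseteq> (degree_filtration n :: 'k free_alg set)"
    unfolding degree_filtration_def by (intro free_alg.span_mono) auto
  then show "\<exists>a\<in>extremal_ideal. \<exists>b\<in>degree_filtration n. monomial w = a + (b :: 'k free_alg)"
    using ab by blast
qed

definition extremal_basis :: "gen list list" where
  "extremal_basis = [[], [GX], [GY], [GX, GY], [GY, GX], [GX, GY, GX], [GY, GX, GY], [GX, GY, GX, GY]]"

lemma length_extremal_basis: "length extremal_basis = 8"
  by (simp add: extremal_basis_def)

lemma alternating_short_words:
  "distinct_adj w \<Longrightarrow> length w \<le> 4 \<Longrightarrow> w \<in> set extremal_basis \<union> {[GY, GX, GY, GX]}"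
proof (induction w)
  case (Cons g w)
  then have "w \<in> set extremal_basis \<union> {[GY, GX, GY, GX]}" by (cases w) auto
  then show ?case using Cons.prems by (cases g) (auto simp: extremal_basis_def)
qed (simp add: extremal_basis_def)

text \<open>
  A repeated letter is replaced by a longer word, so the induction runs downwards in length, from the
  words of length at least 5, which lie in the closure.
\<close>

lemma extremal_basis_spans:
  fixes p :: "'k::field free_alg"
  shows "\<exists>q\<in>free_alg.span (monomial ` set extremal_basis). p - q \<in> ideal_closure extremal_ideal"
proof -
  let ?J = "ideal_closure extremal_ideal :: 'k free_alg set"
  let ?E = "free_alg.span (monomial ` set extremal_basis) :: 'k free_alg set"
  let ?U = "{p. \<exists>q\<in>?E. p - q \<in> ?J}"
  note J = ideal_closed[OF ideal_ideal_closure[OF ideal_potential_ideal]]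
  have J_U: "p \<in> ?J \<Longrightarrow> p \<in> ?U" for p
    using free_alg.span_zero by force
  have E_U: "p \<in> ?E \<Longrightarrow> p \<in> ?U" for p
    using J(1) by force
  have U_add: "p + q \<in> ?U" if pq: "p \<in> ?U" "q \<in> ?U" for p q
  proof -
    obtain p' q' where "p' \<in> ?E" "p - p' \<in> ?J" "q' \<in> ?E" "q - q' \<in> ?J" using pq by auto
    then show ?thesis
      using free_alg.span_add[of p' _ q'] J(2)[of "p - p'" _ "q - q'"]
      by (auto intro!: bexI[of _ "p' + q'"] simp: algebra_simps)
  qed
  have scale: "scale c p \<in> ?U" if p: "p \<in> ?U" for c p
  proof -
    obtain p' where p': "p' \<in> ?E" "p - p' \<in> ?J" using p by auto
    show ?thesis
      using free_alg.span_scale[OF p'(1), of c] J(7)[OF p'(2), of c]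
      by (auto simp: free_alg.scale_right_diff_distrib)
  qed
  have diff: "p - q \<in> ?U" if "p \<in> ?U" "q \<in> ?U" for p q
    using U_add[OF that(1) scale[OF that(2), of "- 1"]] by (simp add: free_alg.scale_minus_left)
  have "monomial w \<in> ?U" for w
  proof (induction "5 - length w" arbitrary: w rule: less_induct)
    case less
    consider "5 \<le> length w" | "length w \<le> 4" "distinct_adj w" | "length w \<le> 4" "\<not> distinct_adj w"
      by linarith
    then show ?case
    proof cases
      case 1
      then show ?thesis by (intro J_U long_word_in_closure)
    next
      case 2
      have base: "monomial w \<in> ?U" if "w \<in> set extremal_basis" for w
        using that by (intro E_U) (simp add: free_alg.span_base)
      have "monomial [GX, GY, GX, GY] - (monomial [GX, GY, GX, GY] - monomial [GY, GX, GY, GX]) \<in> ?U"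
        using alternating_words_congruent[of "[]" "[]"] ideal_subset_closure
        by (intro diff base J_U) (auto simp: extremal_basis_def)
      then show ?thesis using alternating_short_words[OF 2(2,1)] base by auto
    next
      case 3
      then obtain u g v where w: "w = u @ [g, g] @ v" using not_distinct_adj_split by blast
      obtain w' where w': "length w' = length w + 1"
        "monomial w + monomial w' \<in> (extremal_ideal :: 'k free_alg set)"
        using double_letter_reduces unfolding w by blast
      have "monomial w' \<in> ?U" using less[of w'] w'(1) 3(1) by simp
      moreover have "monomial w + monomial w' \<in> ?U" using w'(2) ideal_subset_closure J_U by blast
      ultimately show ?thesis using diff[of "monomial w + monomial w'" "monomial w'"] by simp
    qed
  qed
  then have words: "monomial w \<in> ?U" for w .
  have "p \<in> ?U"
  proof (induction p rule: free_alg_induct)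
    case (single w c)
    show ?case unfolding single_eq_scale by (rule scale[OF words])
  next
    case (add p q)
    then show ?case by (rule U_add)
  qed
  then show ?thesis by simp
qed

lemma dim_completion_extremal: "dim_completion (extremal_potential :: 'k::field free_alg) = 8"
proof (rule antisym)
  let ?J = "ideal_closure extremal_ideal :: 'k free_alg set"
  have "?J \<noteq> UNIV"
    using card_spanning_set_modulo_closure[OF potential_extremal terms_degree_ge_extremal, of "{}"]
    by auto
  then have "dim_completion (extremal_potential :: 'k free_alg)
      \<le> enat (length (map monomial extremal_basis :: 'k free_alg list))"
    unfolding dim_completion_def completed_potential_algebra_def
    using extremal_basis_spans
    by (intro ring_dim_Quot_le ideal_ideal_closure ideal_potential_ideal) auto
  then show "dim_completion (extremal_potential :: 'k free_alg) \<le> 8"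
    by (simp add: length_extremal_basis numeral_eq_enat)
  show "8 \<le> dim_completion (extremal_potential :: 'k free_alg)"
    by (rule dim_completion_ge_8[OF potential_extremal terms_degree_ge_extremal])
qed

theorem theorem1p4:
  shows "(\<forall>F :: 'k::field free_alg. potential F \<and> terms_degree_ge 3 F \<longrightarrow>
             8 \<le> dim_potential_algebra F) \<and>
         (\<forall>F :: 'k free_alg. potential F \<and> terms_degree_ge 3 F \<longrightarrow>
             8 \<le> dim_completion F) \<and>
         (\<exists>F :: 'k free_alg. potential F \<and> terms_degree_ge 3 F \<and>
             dim_completion F = 8)"
  using dim_potential_algebra_ge_8 dim_completion_ge_8 dim_completion_extremal
    potential_extremal terms_degree_ge_extremal
  by blast

end
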